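(* For $\theta\in[-1,0)$ and $a\ge-1/\theta$ we have $p_0^a(\theta)=1$ and, for $n\ge1$, $$p_n^a(\theta)=\frac{(-1)^{n+1}}{(1+a)^{n+1}}\sum_{k=0}^{n+1}\frac{\theta^{k(k-3)/2}}{k!}\,\phi_{n+1-k}(\theta).$$
   Context: For $a\in(-1,\infty)$ and $\theta\in\mathbb R$, let $X_1,X_2,\ldots$ be i.i.d. random variables uniformly distributed on $[-a,1]$. Set $p_0^a(\theta):=1$ and, for $n\ge1$, $$p_n^a(\theta):=\mathbb P(X_2\ge\theta X_1,\,X_3\ge\theta X_2,\,\ldots,\,X_{n+1}\ge\theta X_n).$$ For an integer $\ell\ge1$, an $\ell$-profile is a vector $\mathbf r=(r_1,\ldots,r_\ell)$ of integers $r_i\ge0$ with $\sum_{i=1}^\ell i\,r_i=\ell$. Define $\phi_0(\theta):=1$ and, for $\ell\ge1$, $$\phi_\ell(\theta):=\sum_{\ell\text{-profile }\mathbf r}\binom{\sum_{i=1}^\ell r_i}{r_1,\ldots,r_\ell}\prod_{i=1}^\ell\left[\frac{-\theta^{i(i-1)/2}}{i!}\right]^{r_i},$$ where the sum is over all $\ell$-profiles and $\binom{\sum_i r_i}{r_1,\ldots,r_\ell}=\frac{(\sum_i r_i)!}{\prod_j r_j!}$ is the multinomial coefficient. *)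

theory Defs
  imports "HOL-Probability.Probability"
begin

definition persistence_prob :: "'a measure \<Rightarrow> (nat \<Rightarrow> 'a \<Rightarrow> real) \<Rightarrow> real \<Rightarrow> nat \<Rightarrow> real" where
  "persistence_prob M X \<theta> n =
     (if n = 0 then 1
      else measure M {\<omega> \<in> space M. \<forall>i\<in>{1..n}. X (i + 1) \<omega> \<ge> \<theta> * X i \<omega>})"

(* A profile (r_1, ..., r_l) is a function on {1..l}, extended by undefined outside {1..l}
   so that distinct elements of the set are distinct vectors. *)
definition profiles :: "nat \<Rightarrow> (nat \<Rightarrow> nat) set" where
  "profiles l = {r \<in> {1..l} \<rightarrow>\<^sub>E UNIV. (\<Sum>i=1..l. i * r i) = l}"

lemma finite_profiles: "finite (profiles l)"
proof (rule finite_subset)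
  show "profiles l \<subseteq> {1..l} \<rightarrow>\<^sub>E {..l}"
  proof
    fix r assume r: "r \<in> profiles l"
    have "r i \<le> l" if i: "i \<in> {1..l}" for i
    proof -
      have "r i \<le> i * r i" using i by simp
      also have "\<dots> \<le> (\<Sum>j=1..l. j * r j)"
        using i by (intro member_le_sum) auto
      also have "\<dots> = l" using r by (simp add: profiles_def)
      finally show ?thesis .
    qed
    with r show "r \<in> {1..l} \<rightarrow>\<^sub>E {..l}"
      by (auto simp: profiles_def PiE_iff)
  qed
  show "finite ({1..l} \<rightarrow>\<^sub>E {..l})"
    by (intro finite_PiE) auto
qed

(* The natural-number div is exact, since i * (i - 1) is even. *)
definition phi :: "nat \<Rightarrow> real \<Rightarrow> real" where
  "phi l \<theta> =
     (if l = 0 then 1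
      else (\<Sum>r\<in>profiles l.
              (fact (\<Sum>i=1..l. r i) / (\<Prod>i=1..l. fact (r i))) *
              (\<Prod>i=1..l. ((- (\<theta> ^ (i * (i - 1) div 2))) / fact i) ^ r i)))"

end

theory Submission
  imports Defs
begin

text \<open>
  Since \<open>\<theta> < 0\<close> and all variables are at most \<open>1\<close>, a value below \<open>1 / \<theta>\<close> cannot be followed by an
  admissible one; and since \<open>a \<ge> - 1 / \<theta>\<close>, the lower end \<open>-a\<close> of the interval never matters. So the
  probability is \<open>(1 + a)\<^bsup>-(n + 1)\<^esup>\<close> times the volume of a region that does not depend on \<open>a\<close>.

  Let \<open>G\<^sub>n x\<close> be the volume of the admissible continuations of length \<open>n\<close> of a chain at \<open>x\<close>. Then
  \<open>G\<^sub>0 = 1\<close>, and \<open>G\<^sub>n\<^sub>+\<^sub>1 x\<close> is the integral of \<open>G\<^sub>n\<close> over \<open>{\<theta> * x..1}\<close>; that is,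
  \<open>G\<^sub>n\<^sub>+\<^sub>1' x = - \<theta> * G\<^sub>n (\<theta> * x)\<close> and \<open>G\<^sub>n\<^sub>+\<^sub>1 (1 / \<theta>) = 0\<close>. The differential equation is solved by
  polynomials whose coefficients contain one free constant for each degree. The boundary condition
  turns into a convolution identity for these constants (\<open>phi_convolution\<close>). It says that they are,
  up to sign, the coefficients of the power series \<open>1 / (\<Sum>\<^sub>k \<theta>\<^bsup>k(k-1)/2\<^esup> z\<^sup>k / k!)\<close>, and expanding this
  reciprocal as a geometric series gives the sums over profiles that define \<open>phi\<close>. The recursion
  (\<open>sum_profiles_rec\<close>) is proved directly, by lowering one component of the profile.

  The volume sought is the integral of \<open>G\<^sub>n\<close> over \<open>{1 / \<theta>..1}\<close>, which is \<open>G\<^sub>n\<^sub>+\<^sub>1\<close> at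
  \<open>1 / \<theta>\<^sup>2\<close> (\<open>survival_poly_inverse_square\<close>). The link with the random variables is
  \<open>nn_integral_chain_event\<close>, an induction that splits off the first variable.
\<close>

section \<open>The recursion for sums over profiles\<close>

text \<open>
  For a fixed bound \<open>L\<close>, the profiles of every \<open>l \<le> L\<close> can be taken to be functions that vanish
  outside \<open>{1..L}\<close>. Decrementing a component, which lowers \<open>l\<close>, then does not change the ambient
  index set.
\<close>
definition supp_profiles :: "nat \<Rightarrow> nat \<Rightarrow> (nat \<Rightarrow> nat) set" where
  "supp_profiles L l = {r. (\<forall>i. i \<notin> {1..L} \<longrightarrow> r i = 0) \<and> (\<Sum>i=1..L. i * r i) = l}"

text \<open>
  The weight of a profile, for arbitrary coefficients \<open>b\<close>: the multinomial coefficient of its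
  components times \<open>\<Prod>\<^sub>i b\<^sub>i\<^bsup>r\<^sub>i\<^esup>\<close>.
\<close>
definition profile_weight :: "(nat \<Rightarrow> 'a::field_char_0) \<Rightarrow> nat \<Rightarrow> (nat \<Rightarrow> nat) \<Rightarrow> 'a" where
  "profile_weight b L r =
     fact (\<Sum>i=1..L. r i) / (\<Prod>i=1..L. fact (r i)) * (\<Prod>i=1..L. b i ^ r i)"

lemma profile_component_le:
  fixes r :: "nat \<Rightarrow> nat"
  assumes "(\<Sum>i=1..L. i * r i) = l" "i \<in> {1..L}"
  shows "i * r i \<le> l"
  using member_le_sum[of i "{1..L}" "\<lambda>i. i * r i"] assms by simp

lemma supp_profiles_zero_above:
  assumes "r \<in> supp_profiles L l" "i \<notin> {1..l}"
  shows "r i = 0"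
proof (cases "i \<in> {1..L}")
  case True
  then have "i * r i \<le> l" "l < i"
    using assms profile_component_le[of r L l i] by (auto simp: supp_profiles_def)
  then show ?thesis
    by (cases "r i") auto
qed (use assms in \<open>auto simp: supp_profiles_def\<close>)

lemma bij_betw_supp_profiles:
  assumes "l \<le> L"
  shows "bij_betw (\<lambda>r. restrict r {1..l}) (supp_profiles L l) (profiles l)"
proof (rule bij_betw_byWitness[where f' = "\<lambda>r i. if i \<in> {1..l} then r i else 0"])
  show "\<forall>r\<in>supp_profiles L l. (\<lambda>i. if i \<in> {1..l} then restrict r {1..l} i else 0) = r"
    by (auto simp: fun_eq_iff dest: supp_profiles_zero_above)
  show "\<forall>r\<in>profiles l. restrict (\<lambda>i. if i \<in> {1..l} then r i else 0) {1..l} = r"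
    by (auto simp: profiles_def fun_eq_iff PiE_def extensional_def restrict_def)
  show "(\<lambda>r. restrict r {1..l}) ` supp_profiles L l \<subseteq> profiles l"
  proof safe
    fix r assume r: "r \<in> supp_profiles L l"
    have "(\<Sum>i=1..l. i * r i) = (\<Sum>i=1..L. i * r i)"
      using assms supp_profiles_zero_above[OF r] by (intro sum.mono_neutral_left) auto
    with r show "restrict r {1..l} \<in> profiles l"
      by (auto simp: profiles_def supp_profiles_def)
  qed
  show "(\<lambda>r i. if i \<in> {1..l} then r i else 0) ` profiles l \<subseteq> supp_profiles L l"
  proof safe
    fix r assume r: "r \<in> profiles l"
    have "(\<Sum>i=1..L. i * (if i \<in> {1..l} then r i else 0)) =
        (\<Sum>i=1..l. i * (if i \<in> {1..l} then r i else 0))"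
      using assms by (intro sum.mono_neutral_right) auto
    also have "\<dots> = l"
      using r by (simp add: profiles_def)
    finally show "(\<lambda>i. if i \<in> {1..l} then r i else 0) \<in> supp_profiles L l"
      using assms by (auto simp: supp_profiles_def)
  qed
qed

lemma finite_supp_profiles: "l \<le> L \<Longrightarrow> finite (supp_profiles L l)"
  using bij_betw_supp_profiles[of l L] bij_betw_finite finite_profiles by blast

lemma profile_weight_restrict:
  assumes "l \<le> L" "r \<in> supp_profiles L l"
  shows "profile_weight b l (restrict r {1..l}) = profile_weight b L r"
proof -
  note z = supp_profiles_zero_above[OF assms(2)]
  have "(\<Sum>i=1..l. r i) = (\<Sum>i=1..L. r i)"
    using assms z by (intro sum.mono_neutral_left) auto
  moreover have "(\<Prod>i=1..l. fact (r i) :: 'a) = (\<Prod>i=1..L. fact (r i))"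
    using assms z by (intro prod.mono_neutral_left) auto
  moreover have "(\<Prod>i=1..l. b i ^ r i) = (\<Prod>i=1..L. b i ^ r i)"
    using assms z by (intro prod.mono_neutral_left) auto
  moreover have "profile_weight b l (restrict r {1..l}) = profile_weight b l r"
    unfolding profile_weight_def
    by (intro arg_cong2[where f = "(*)"] arg_cong2[where f = "(/)"] arg_cong[where f = fact]
        sum.cong prod.cong) auto
  ultimately show ?thesis
    by (simp add: profile_weight_def)
qed

lemma sum_profiles_eq:
  assumes "l \<le> L"
  shows "(\<Sum>r\<in>profiles l. profile_weight b l r) = (\<Sum>r\<in>supp_profiles L l. profile_weight b L r)"
proof -
  have "(\<Sum>r\<in>profiles l. profile_weight b l r) =
      (\<Sum>r\<in>supp_profiles L l. profile_weight b l (restrict r {1..l}))"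
    by (rule sum.reindex_bij_betw[OF bij_betw_supp_profiles[OF assms], symmetric])
  also have "\<dots> = (\<Sum>r\<in>supp_profiles L l. profile_weight b L r)"
    by (intro sum.cong refl profile_weight_restrict assms)
  finally show ?thesis .
qed

text \<open>The Pascal rule for multinomial coefficients, multiplied by the powers of \<open>b\<close>.\<close>
lemma profile_weight_rec:
  assumes "(\<Sum>i=1..L. r i) > 0"
  shows "profile_weight b L r =
    (\<Sum>j | j \<in> {1..L} \<and> r j > 0. b j * profile_weight b L (r(j := r j - 1)))"
proof -
  obtain m where m: "(\<Sum>i=1..L. r i) = Suc m"
    using assms gr0_conv_Suc by blast
  define P where "P = (\<Prod>i=1..L. fact (r i) :: 'a)"
  define B where "B = (\<Prod>i=1..L. b i ^ r i)"
  have P0: "P \<noteq> 0" by (simp add: P_def)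
  have step: "b j * profile_weight b L (r(j := r j - 1)) = of_nat (r j) * (fact m / P * B)"
    if j: "j \<in> {1..L}" "r j > 0" for j
  proof -
    obtain q where q: "r j = Suc q" using j gr0_conv_Suc by blast
    have S: "(\<Sum>i=1..L. (r(j := r j - 1)) i) = m"
      using j m q by (simp add: sum.remove[of _ j])
    have P: "P = of_nat (r j) * (\<Prod>i=1..L. fact ((r(j := r j - 1)) i))"
      using j q by (simp add: P_def prod.remove[of _ j])
    have B: "B = b j * (\<Prod>i=1..L. b i ^ (r(j := r j - 1)) i)"
      using j q by (simp add: B_def prod.remove[of _ j])
    have "(of_nat (r j) :: 'a) \<noteq> 0" using j by simp
    then show ?thesis
      unfolding profile_weight_def S P B by (simp add: field_simps)
  qed
  have "(\<Sum>j | j \<in> {1..L} \<and> r j > 0. b j * profile_weight b L (r(j := r j - 1))) =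
      (\<Sum>j | j \<in> {1..L} \<and> r j > 0. of_nat (r j) * (fact m / P * B))"
    using step by (intro sum.cong) auto
  also have "\<dots> = of_nat (\<Sum>j | j \<in> {1..L} \<and> r j > 0. r j) * (fact m / P * B)"
    unfolding of_nat_sum by (rule sum_distrib_right[symmetric])
  also have "(\<Sum>j | j \<in> {1..L} \<and> r j > 0. r j) = (\<Sum>j=1..L. r j)"
    by (intro sum.mono_neutral_left) auto
  also have "of_nat \<dots> * (fact m / P * B) = profile_weight b L r"
    unfolding profile_weight_def m P_def B_def by (simp add: algebra_simps)
  finally show ?thesis ..
qed

lemma bij_betw_decrement:
  assumes "j \<in> {1..L}" "j \<le> l"
  shows "bij_betw (\<lambda>r. r(j := r j - 1)) {r \<in> supp_profiles L l. r j > 0} (supp_profiles L (l - j))"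
proof (rule bij_betw_byWitness[where f' = "\<lambda>r. r(j := Suc (r j))"])
  have split: "(\<Sum>i=1..L. i * r i) = j * r j + (\<Sum>i\<in>{1..L} - {j}. i * r i)" for r :: "nat \<Rightarrow> nat"
    using assms by (simp add: sum.remove)
  show "(\<lambda>r. r(j := r j - 1)) ` {r \<in> supp_profiles L l. 0 < r j} \<subseteq> supp_profiles L (l - j)"
  proof safe
    fix r assume r: "r \<in> supp_profiles L l" "r j > 0"
    then obtain q where "r j = Suc q" using gr0_conv_Suc by blast
    with r assms show "r(j := r j - 1) \<in> supp_profiles L (l - j)"
      unfolding supp_profiles_def split by auto
  qed
  show "(\<lambda>r. r(j := Suc (r j))) ` supp_profiles L (l - j) \<subseteq> {r \<in> supp_profiles L l. 0 < r j}"
    using assms unfolding supp_profiles_def split by auto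
qed auto

text \<open>
  In terms of generating functions: the sums \<open>W\<^sub>l\<close> over the profiles of \<open>l\<close> satisfy
  \<open>\<Sum>\<^sub>l W\<^sub>l z\<^sup>l = 1 / (1 - \<Sum>\<^sub>i b\<^sub>i z\<^sup>i)\<close>.
\<close>
lemma sum_profiles_rec:
  assumes "l > 0"
  shows "(\<Sum>r\<in>profiles l. profile_weight b l r) =
    (\<Sum>j=1..l. b j * (\<Sum>r\<in>profiles (l - j). profile_weight b (l - j) r))"
proof -
  let ?w = "profile_weight b l" and ?S = "supp_profiles l"
  have fin: "finite (?S l)" by (simp add: finite_supp_profiles)
  have pos: "(\<Sum>i=1..l. r i) > 0" if "r \<in> ?S l" for r
  proof (rule ccontr)
    assume "\<not> (\<Sum>i=1..l. r i) > 0"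
    then have "(\<Sum>i=1..l. i * r i) = 0" by simp
    then show False using that assms by (auto simp: supp_profiles_def)
  qed
  have "(\<Sum>r\<in>profiles l. ?w r) = (\<Sum>r\<in>?S l. ?w r)"
    by (rule sum_profiles_eq) simp
  also have "\<dots> = (\<Sum>r\<in>?S l. \<Sum>j | j \<in> {1..l} \<and> r j > 0. b j * ?w (r(j := r j - 1)))"
    by (intro sum.cong refl profile_weight_rec pos)
  also have "\<dots> = (\<Sum>j\<in>{1..l}. \<Sum>r | r \<in> ?S l \<and> r j > 0. b j * ?w (r(j := r j - 1)))"
    using fin by (intro sum.swap_restrict) auto
  also have "\<dots> = (\<Sum>j\<in>{1..l}. b j * (\<Sum>r\<in>profiles (l - j). profile_weight b (l - j) r))"
  proof (intro sum.cong refl)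
    fix j assume j: "j \<in> {1..l}"
    have "(\<Sum>r | r \<in> ?S l \<and> r j > 0. b j * ?w (r(j := r j - 1))) = (\<Sum>r\<in>?S (l - j). b j * ?w r)"
      using j by (intro sum.reindex_bij_betw[OF bij_betw_decrement]) auto
    also have "\<dots> = b j * (\<Sum>r\<in>?S (l - j). ?w r)" 
      by (simp add: sum_distrib_left)
    also have "(\<Sum>r\<in>?S (l - j). ?w r) = (\<Sum>r\<in>profiles (l - j). profile_weight b (l - j) r)"
      by (rule sum_profiles_eq[symmetric]) simp
    finally show "(\<Sum>r | r \<in> ?S l \<and> r j > 0. b j * ?w (r(j := r j - 1))) =
      b j * (\<Sum>r\<in>profiles (l - j). profile_weight b (l - j) r)" .
  qed
  finally show ?thesis .
qed

lemma phi_eq_sum_profiles: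
  "phi l \<theta> = (\<Sum>r\<in>profiles l. profile_weight (\<lambda>i. - (\<theta> ^ (i * (i - 1) div 2)) / fact i) l r)"
proof (cases "l = 0")
  case True
  then show ?thesis by (simp add: phi_def profiles_def profile_weight_def)
qed (simp add: phi_def profile_weight_def)

lemma phi_convolution:
  assumes "n > 0"
  shows "(\<Sum>k\<le>n. phi (n - k) \<theta> * \<theta> ^ (k * (k - 1) div 2) / fact k) = 0"
proof -
  have "phi n \<theta> = (\<Sum>j=1..n. - (\<theta> ^ (j * (j - 1) div 2)) / fact j * phi (n - j) \<theta>)"
    unfolding phi_eq_sum_profiles by (rule sum_profiles_rec[OF assms])
  then have "phi n \<theta> + (\<Sum>j=1..n. \<theta> ^ (j * (j - 1) div 2) / fact j * phi (n - j) \<theta>) = 0"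
    by (simp add: sum_negf)
  moreover have "(\<Sum>k\<le>n. phi (n - k) \<theta> * \<theta> ^ (k * (k - 1) div 2) / fact k) =
     phi n \<theta> + (\<Sum>j=1..n. phi (n - j) \<theta> * \<theta> ^ (j * (j - 1) div 2) / fact j)"
    by (simp add: atMost_atLeast0 sum.atLeast_Suc_atMost)
  ultimately show ?thesis by (simp add: mult_ac)
qed

section \<open>The survival polynomials\<close>

text \<open>
  For \<open>x\<close> between \<open>1 / \<theta>\<close> and \<open>1 / \<theta>\<^sup>2\<close>, this is \<open>(1 + a)\<^sup>n\<close> times the probability that a chain
  started at \<open>x\<close> survives \<open>n\<close> further steps; no \<open>a\<close> occurs in it. The coefficients are forced by \<open>survival_poly_deriv\<close> up to the constant terms, and
  those are fixed by \<open>survival_poly_inverse\<close>.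
\<close>
definition survival_poly :: "real \<Rightarrow> nat \<Rightarrow> real \<Rightarrow> real" where
  "survival_poly \<theta> n x =
     (-1) ^ n * (\<Sum>k\<le>n. phi (n - k) \<theta> * \<theta> ^ (k * (k + 1) div 2) * x ^ k / fact k)"

lemma triangle_Suc: "Suc k * (Suc k + 1) div 2 = k * (k + 1) div 2 + k + 1"
proof -
  have "Suc k * (Suc k + 1) = k * (k + 1) + (k + 1) * 2"
    by (simp add: algebra_simps)
  then show ?thesis by (simp only: div_mult_self3) simp
qed

lemma survival_poly_0 [simp]: "survival_poly \<theta> 0 x = 1"
  by (simp add: survival_poly_def phi_def)

lemma survival_poly_deriv:
  "(survival_poly \<theta> (Suc n) has_real_derivative - \<theta> * survival_poly \<theta> n (\<theta> * x)) (at x)"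
proof -
  define c where "c k = phi (Suc n - k) \<theta> * \<theta> ^ (k * (k + 1) div 2)" for k
  have "((\<lambda>x. c k * x ^ k / fact k) has_real_derivative
      c k * (of_nat k * x ^ (k - 1)) / fact k) (at x)" for k
    by (auto intro!: derivative_eq_intros)
  then have "(survival_poly \<theta> (Suc n) has_real_derivative
      (-1) ^ Suc n * (\<Sum>k\<le>Suc n. c k * (of_nat k * x ^ (k - 1)) / fact k)) (at x)"
    unfolding survival_poly_def[abs_def] c_def by (intro DERIV_cmult DERIV_sum)
  also have "(\<Sum>k\<le>Suc n. c k * (of_nat k * x ^ (k - 1)) / fact k) =
      (\<Sum>k\<le>n. c (Suc k) * (of_nat (Suc k) * x ^ k) / fact (Suc k))"
    by (subst sum.atMost_Suc_shift) simp
  also have "\<dots> = (\<Sum>k\<le>n. \<theta> * (phi (n - k) \<theta> * \<theta> ^ (k * (k + 1) div 2) * (\<theta> * x) ^ k / fact k))"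
  proof (intro sum.cong refl)
    fix k
    have "c (Suc k) = phi (n - k) \<theta> * \<theta> ^ (k * (k + 1) div 2) * \<theta> ^ k * \<theta>"
      unfolding c_def triangle_Suc by (simp add: power_add)
    moreover have "of_nat (Suc k) / fact (Suc k) = (1 / fact k :: real)"
      by (simp add: field_simps del: of_nat_Suc)
    ultimately show "c (Suc k) * (of_nat (Suc k) * x ^ k) / fact (Suc k) =
        \<theta> * (phi (n - k) \<theta> * \<theta> ^ (k * (k + 1) div 2) * (\<theta> * x) ^ k / fact k)"
      by (simp add: power_mult_distrib field_simps del: of_nat_Suc fact_Suc)
  qed
  also have "(-1) ^ Suc n * \<dots> = - \<theta> * survival_poly \<theta> n (\<theta> * x)"
    by (simp add: survival_poly_def sum_distrib_left mult_ac)
  finally show ?thesis .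
qed

text \<open>
  A chain at \<open>1 / \<theta>\<close> has to jump to at least \<open>1\<close>, so it survives with probability zero. This is where
  the defining property of the numbers \<open>phi\<close> enters.
\<close>
lemma survival_poly_inverse:
  assumes "\<theta> \<noteq> 0" "n > 0"
  shows "survival_poly \<theta> n (1 / \<theta>) = 0"
proof -
  have "\<theta> ^ (k * (k + 1) div 2) * (1 / \<theta>) ^ k = \<theta> ^ (k * (k - 1) div 2)" for k
  proof (cases k)
    case (Suc j)
    have "k * (k + 1) div 2 = k * (k - 1) div 2 + k"
      unfolding Suc triangle_Suc by (simp add: mult.commute)
    then show ?thesis
      using assms by (simp add: power_add power_one_over)
  qed simp
  then have "survival_poly \<theta> n (1 / \<theta>) =
      (-1) ^ n * (\<Sum>k\<le>n. phi (n - k) \<theta> * \<theta> ^ (k * (k - 1) div 2) / fact k)"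
    unfolding survival_poly_def by (simp add: mult.assoc)
  then show ?thesis
    using phi_convolution[OF assms(2), of \<theta>] by simp
qed

lemma survival_poly_antideriv:
  assumes "\<theta> \<noteq> 0"
  shows "((\<lambda>y. - survival_poly \<theta> (Suc n) (y / \<theta>)) has_real_derivative survival_poly \<theta> n y) (at y)"
proof -
  have "((\<lambda>y. survival_poly \<theta> (Suc n) (y / \<theta>)) has_real_derivative
      - \<theta> * survival_poly \<theta> n (\<theta> * (y / \<theta>)) * (1 / \<theta>)) (at y)"
    by (rule DERIV_chain2[OF survival_poly_deriv]) (use assms in \<open>auto intro!: derivative_eq_intros\<close>)
  then show ?thesis
    using assms by (auto dest: DERIV_minus)
qed

lemma one_le_inverse_square:
  fixes \<theta> :: real
  assumes "-1 \<le> \<theta>" "\<theta> < 0"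
  shows "1 \<le> 1 / \<theta>\<^sup>2"
proof -
  have "\<theta>\<^sup>2 \<le> 1" using assms abs_square_le_1[of \<theta>] by simp
  then show ?thesis using assms by simp
qed

text \<open>
  The interval from \<open>1 / \<theta>\<close> to \<open>1 / \<theta>\<^sup>2\<close> contains all values reached in one surviving step from any
  of its points, since all variables are at most \<open>1\<close>.
\<close>
lemma survival_interval:
  fixes \<theta> :: real
  assumes "-1 \<le> \<theta>" "\<theta> < 0" "x \<in> {1 / \<theta>..1 / \<theta>\<^sup>2}"
  shows "\<theta> * x \<in> {1 / \<theta>..1}" "{\<theta> * x..1} \<subseteq> {1 / \<theta>..1 / \<theta>\<^sup>2}"
proof -
  have "\<theta> * (1 / \<theta>\<^sup>2) \<le> \<theta> * x" "\<theta> * x \<le> \<theta> * (1 / \<theta>)"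
    using assms by (simp_all add: mult_left_mono_neg del: times_divide_eq_right)
  moreover have "\<theta> * (1 / \<theta>\<^sup>2) = 1 / \<theta>" "\<theta> * (1 / \<theta>) = 1"
    using assms by (simp_all add: power2_eq_square)
  ultimately show "\<theta> * x \<in> {1 / \<theta>..1}" by simp
  then show "{\<theta> * x..1} \<subseteq> {1 / \<theta>..1 / \<theta>\<^sup>2}"
    using order.trans[OF _ one_le_inverse_square[OF assms(1,2)]] by auto
qed

lemma survival_poly_nonneg:
  assumes "-1 \<le> \<theta>" "\<theta> < 0" "x \<in> {1 / \<theta>..1 / \<theta>\<^sup>2}"
  shows "survival_poly \<theta> n x \<ge> 0"
  using assms(3)
proof (induction n arbitrary: x)
  case (Suc n)
  note iv = survival_interval[OF assms(1,2) Suc.prems]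
  have "- survival_poly \<theta> (Suc n) (\<theta> * x / \<theta>) \<le> - survival_poly \<theta> (Suc n) (1 / \<theta>)"
  proof (rule DERIV_nonneg_imp_nondecreasing[where f = "\<lambda>y. - survival_poly \<theta> (Suc n) (y / \<theta>)"])
    show "\<theta> * x \<le> 1" using iv by simp
    fix y assume "\<theta> * x \<le> y" "y \<le> 1"
    then have "y \<in> {1 / \<theta>..1 / \<theta>\<^sup>2}" using iv by auto
    then show "\<exists>d. ((\<lambda>y. - survival_poly \<theta> (Suc n) (y / \<theta>)) has_real_derivative d) (at y) \<and> d \<ge> 0"
      using survival_poly_antideriv[of \<theta> n y] assms Suc.IH by auto
  qed
  then show ?case
    using assms survival_poly_inverse[of \<theta> "Suc n"] by simp
qed simp

lemma borel_measurable_survival_poly [measurable]: "survival_poly \<theta> n \<in> borel_measurable borel"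
  unfolding survival_poly_def[abs_def] by measurable

lemma nn_integral_survival_poly:
  assumes "-1 \<le> \<theta>" "\<theta> < 0" "x \<in> {1 / \<theta>..1 / \<theta>\<^sup>2}"
  shows "(\<integral>\<^sup>+y. ennreal (survival_poly \<theta> n y) * indicator {\<theta> * x..1} y \<partial>lborel) =
    ennreal (survival_poly \<theta> (Suc n) x)"
proof -
  note iv = survival_interval[OF assms]
  have "(\<integral>\<^sup>+y. ennreal (survival_poly \<theta> n y) * indicator {\<theta> * x..1} y \<partial>lborel) =
      ennreal (- survival_poly \<theta> (Suc n) (1 / \<theta>) - - survival_poly \<theta> (Suc n) (\<theta> * x / \<theta>))"
  proof (intro nn_integral_FTC_Icc survival_poly_antideriv)
    show "\<theta> \<noteq> 0" "\<theta> * x \<le> 1" using assms iv(1) by auto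
    show "0 \<le> survival_poly \<theta> n y" if "y \<in> {\<theta> * x..1}" for y
      using that iv(2) by (intro survival_poly_nonneg assms) blast
  qed measurable
  then show ?thesis
    using assms survival_poly_inverse[of \<theta> "Suc n"] by simp
qed

text \<open>
  At \<open>1 / \<theta>\<^sup>2\<close> the exponents \<open>k (k + 1) / 2\<close> drop by \<open>2 k\<close>, which yields the exponents
  \<open>k (k - 3) / 2\<close> of the theorem.
\<close>
lemma survival_poly_inverse_square:
  assumes "\<theta> \<noteq> 0"
  shows "survival_poly \<theta> n (1 / \<theta>\<^sup>2) =
    (-1) ^ n * (\<Sum>k=0..n. \<theta> powi (int k * (int k - 3) div 2) / fact k * phi (n - k) \<theta>)"
proof -
  have "\<theta> ^ (k * (k + 1) div 2) * (1 / \<theta>\<^sup>2) ^ k = \<theta> powi (int k * (int k - 3) div 2)" for k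
  proof -
    have "int (k * (k + 1) div 2) = int k * (int k + 1) div 2"
      by (simp add: zdiv_int algebra_simps)
    also have "int k * (int k + 1) = int k * (int k - 3) + 2 * (2 * int k)"
      by (simp add: algebra_simps)
    also have "\<dots> div 2 = int k * (int k - 3) div 2 + int (2 * k)"
      by simp
    finally have "int k * (int k - 3) div 2 = int (k * (k + 1) div 2) - int (2 * k)"
      by simp
    then show ?thesis
      using assms by (simp add: power_int_diff power_one_over power_inverse power_mult power_int_of_nat divide_inverse
        del: of_nat_mult)
  qed
  then show ?thesis
    unfolding survival_poly_def by (simp add: mult_ac atMost_atLeast0)
qed

section \<open>Survival of a chain of independent uniform variables\<close>

text \<open>
  The chain with values \<open>x\<^sub>m, \<dots>, x\<^sub>n\<close>, preceded by the value \<open>z\<close>, satisfies all step conditions.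
  For \<open>m > n\<close> the condition is void. The indices start at a variable \<open>m\<close> so that splitting off the
  first variable needs no reindexing.
\<close>
definition chain_event :: "real \<Rightarrow> nat \<Rightarrow> nat \<Rightarrow> real \<Rightarrow> (nat \<Rightarrow> real) \<Rightarrow> bool" where
  "chain_event \<theta> m n z x \<longleftrightarrow> (\<forall>i\<in>{m..n}. \<theta> * (if i = m then z else x (i - 1)) \<le> x i)"

lemma chain_event_insert:
  assumes "m \<le> n"
  shows "chain_event \<theta> m n z (x(m := y)) \<longleftrightarrow> \<theta> * z \<le> y \<and> chain_event \<theta> (Suc m) n y x"
proof -
  have "{m..n} = insert m {Suc m..n}" using assms by auto
  then show ?thesis
    unfolding chain_event_def by auto
qed

lemma sets_chain_event:
  "{x \<in> space (\<Pi>\<^sub>M i\<in>{m..n}. borel). chain_event \<theta> m n z x} \<in> sets (\<Pi>\<^sub>M i\<in>{m..n}. borel)"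
  unfolding chain_event_def
proof (rule sets.sets_Collect_finite_All)
  fix i assume i: "i \<in> {m..n}"
  then have 1: "(\<lambda>x. x i) \<in> borel_measurable (\<Pi>\<^sub>M i\<in>{m..n}. borel)"
    by (intro measurable_component_singleton)
  have 2: "(\<lambda>x. if i = m then z else x (i - 1)) \<in> borel_measurable (\<Pi>\<^sub>M i\<in>{m..n}. borel)"
  proof (cases "i = m")
    case False
    with i have "i - 1 \<in> {m..n}" by auto
    with False show ?thesis by (simp add: measurable_component_singleton)
  qed simp
  show "{x \<in> space (\<Pi>\<^sub>M i\<in>{m..n}. borel). \<theta> * (if i = m then z else x (i - 1)) \<le> x i}
      \<in> sets (\<Pi>\<^sub>M i\<in>{m..n}. borel)"
    by (intro borel_measurable_le borel_measurable_times borel_measurable_const 1 2)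
qed simp

text \<open>
  The survival probability of a chain started at \<open>z\<close>, obtained by integrating over the first
  variable last.
\<close>
lemma nn_integral_chain_event:
  fixes \<theta> a :: real
  assumes \<theta>: "-1 \<le> \<theta>" "\<theta> < 0" and a: "a \<ge> - 1 / \<theta>"
    and m: "m \<le> Suc n" and z: "z \<in> {1 / \<theta>..1 / \<theta>\<^sup>2}"
  defines "U \<equiv> uniform_measure lborel {-a..1::real}"
  shows "(\<integral>\<^sup>+x. indicator {x. chain_event \<theta> m n z x} x \<partial>(\<Pi>\<^sub>M i\<in>{m..n}. U)) =
    ennreal (survival_poly \<theta> (Suc n - m) z / (1 + a) ^ (Suc n - m))"
  using m z
proof (induction m arbitrary: z rule: inc_induct)
  case base
  then show ?case
    by (simp add: chain_event_def PiM_empty)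
next
  case (step m)
  have "- 1 / \<theta> \<ge> 1"
    using \<theta> by (simp add: field_simps)
  with a have a1: "a \<ge> 1" by simp
  have emb: "emeasure lborel {-a..1} = ennreal (1 + a)"
    using a1 by (simp add: add.commute)
  interpret U: prob_space U
    unfolding U_def using a1 by (intro prob_space_uniform_measure) (simp_all add: emb)
  interpret product_sigma_finite "\<lambda>_::nat. U"
    by standard
  have sets_U: "sets U = sets borel" by (simp add: U_def)
  define k where "k = n - m"
  have k: "Suc n - Suc m = k" "Suc n - m = Suc k" "(1 + a) ^ k > 0"
    using step.hyps a1 by (auto simp: k_def)
  have split: "{m..n} = insert m {Suc m..n}" using step.hyps by auto
  have meas: "(indicator {x. chain_event \<theta> m n z x} :: _ \<Rightarrow> ennreal) \<in> borel_measurable (\<Pi>\<^sub>M i\<in>{m..n}. U)"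
  proof -
    have "sets (\<Pi>\<^sub>M i\<in>{m..n}. U) = sets (\<Pi>\<^sub>M i\<in>{m..n}. borel)"
      by (intro sets_PiM_cong refl sets_U)
    moreover from this have "space (\<Pi>\<^sub>M i\<in>{m..n}. U) = space (\<Pi>\<^sub>M i\<in>{m..n}. borel)"
      by (rule sets_eq_imp_space_eq)
    ultimately have "{x. chain_event \<theta> m n z x} \<inter> space (\<Pi>\<^sub>M i\<in>{m..n}. U) \<in> sets (\<Pi>\<^sub>M i\<in>{m..n}. U)"
      using sets_chain_event[of m n \<theta> z] by (simp add: Int_def conj_commute)
    then show ?thesis
      by (simp add: borel_measurable_indicator_iff)
  qed
  have iv: "\<theta> * z \<in> {1 / \<theta>..1}" "{\<theta> * z..1} \<subseteq> {1 / \<theta>..1 / \<theta>\<^sup>2}"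
    using survival_interval[OF \<theta> step.prems] by auto
  have "(\<integral>\<^sup>+x. indicator {x. chain_event \<theta> m n z x} x \<partial>(\<Pi>\<^sub>M i\<in>{m..n}. U)) =
      (\<integral>\<^sup>+y. \<integral>\<^sup>+x. indicator {x. chain_event \<theta> m n z x} (x(m := y)) \<partial>(\<Pi>\<^sub>M i\<in>{Suc m..n}. U) \<partial>U)"
    using meas unfolding split by (intro product_nn_integral_insert_rev) auto
  also have "\<dots> = (\<integral>\<^sup>+y. indicator {\<theta> * z..} y *
      (\<integral>\<^sup>+x. indicator {x. chain_event \<theta> (Suc m) n y x} x \<partial>(\<Pi>\<^sub>M i\<in>{Suc m..n}. U)) \<partial>U)"
    using step.hyps by (intro nn_integral_cong) (auto simp: chain_event_insert indicator_def)
  also have "\<dots> = (\<integral>\<^sup>+y. ennreal (survival_poly \<theta> k y / (1 + a) ^ k) * indicator {\<theta> * z..1} y \<partial>U)"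
  proof (rule nn_integral_cong_AE)
    \<comment> \<open>The induction hypothesis covers only \<open>y \<le> 1 / \<theta>\<^sup>2\<close>, which holds almost surely because \<open>y \<le> 1\<close>.\<close>
    have "AE y in U. y \<in> {-a..1}"
      unfolding U_def by (rule AE_uniform_measureI) auto
    then show "AE y in U. indicator {\<theta> * z..} y *
        (\<integral>\<^sup>+x. indicator {x. chain_event \<theta> (Suc m) n y x} x \<partial>(\<Pi>\<^sub>M i\<in>{Suc m..n}. U)) =
        ennreal (survival_poly \<theta> k y / (1 + a) ^ k) * indicator {\<theta> * z..1} y"
    proof eventually_elim
      case (elim y)
      show ?case
      proof (cases "\<theta> * z \<le> y")
        case True
        then have "y \<in> {1 / \<theta>..1 / \<theta>\<^sup>2}" using elim iv(2) by auto
        with step.IH[of y] True elim k show ?thesis by simp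
      qed simp
    qed
  qed
  also have "\<dots> = (\<integral>\<^sup>+y. ennreal (survival_poly \<theta> k y / (1 + a) ^ k) * indicator {\<theta> * z..1} y *
      indicator {-a..1} y \<partial>lborel) / ennreal (1 + a)"
    unfolding U_def by (subst nn_integral_uniform_measure) (simp_all add: emb)
  also have "(\<integral>\<^sup>+y. ennreal (survival_poly \<theta> k y / (1 + a) ^ k) * indicator {\<theta> * z..1} y *
      indicator {-a..1} y \<partial>lborel) =
      (\<integral>\<^sup>+y. ennreal (1 / (1 + a) ^ k) *
         (ennreal (survival_poly \<theta> k y) * indicator {\<theta> * z..1} y) \<partial>lborel)"
  proof (rule nn_integral_cong)
    fix y
    show "ennreal (survival_poly \<theta> k y / (1 + a) ^ k) * indicator {\<theta> * z..1} y *
      indicator {-a..1} y = ennreal (1 / (1 + a) ^ k) *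
         (ennreal (survival_poly \<theta> k y) * indicator {\<theta> * z..1} y)"
    proof (cases "y \<in> {\<theta> * z..1}")
      case True
      \<comment> \<open>Here \<open>a \<ge> - 1 / \<theta>\<close> makes the lower end of the uniform distribution irrelevant.\<close>
      moreover from this have "y \<ge> -a" using iv(1) a by auto
      moreover have "ennreal (1 / (1 + a) ^ k) * ennreal (survival_poly \<theta> k y) =
          ennreal (survival_poly \<theta> k y / (1 + a) ^ k)"
        using k by (subst ennreal_mult'[symmetric]) auto
      ultimately show ?thesis by simp
    qed simp
  qed
  also have "\<dots> = ennreal (1 / (1 + a) ^ k) * ennreal (survival_poly \<theta> (Suc k) z)"
    by (subst nn_integral_cmult) (simp_all add: nn_integral_survival_poly[OF \<theta> step.prems])
  also have "\<dots> / ennreal (1 + a) = ennreal (survival_poly \<theta> (Suc k) z / (1 + a) ^ Suc k)"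
    using a1 k survival_poly_nonneg[OF \<theta> step.prems, of "Suc k"]
    by (simp add: ennreal_mult'[symmetric] divide_ennreal mult.commute del: ennreal_plus)
  finally show ?case unfolding k .
qed

(* The exponent k (k - 3) / 2 is an integer (the div is exact), negative for k = 1, 2;
   since \<theta> < 0, this has to be an integer power and not powr. *)
theorem corollary9:
  fixes M :: "'a measure" and X :: "nat \<Rightarrow> 'a \<Rightarrow> real" and a \<theta> :: real
  assumes "prob_space M"
    and "prob_space.indep_vars M (\<lambda>_. borel) X {1..}"
    and "\<And>i. i \<ge> 1 \<Longrightarrow> distr M borel (X i) = uniform_measure lborel {-a..1}"
    and "-1 \<le> \<theta>" and "\<theta> < 0" and "a \<ge> - 1 / \<theta>"
  shows "persistence_prob M X \<theta> 0 = 1 \<and>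
    (\<forall>n\<ge>1. persistence_prob M X \<theta> n =
       (- 1) ^ (n + 1) / (1 + a) ^ (n + 1) *
       (\<Sum>k=0..n + 1. \<theta> powi (int k * (int k - 3) div 2) / fact k * phi (n + 1 - k) \<theta>))"
proof (intro conjI allI impI)
  show "persistence_prob M X \<theta> 0 = 1" by (simp add: persistence_prob_def)
next
  fix n :: nat assume n: "n \<ge> 1"
  interpret prob_space M by fact
  define U where "U = uniform_measure lborel {-a..1}"
  \<comment> \<open>A fictitious initial value: the condition on the first step then reads \<open>1 / \<theta> \<le> X 1\<close>.\<close>
  define z where "z = 1 / \<theta>\<^sup>2"
  let ?I = "{1..n + 1}"
  have z: "z \<in> {1 / \<theta>..1 / \<theta>\<^sup>2}"
    using one_le_inverse_square[of \<theta>] assms by (auto simp: z_def intro: order.trans[of _ 0])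
  have X [measurable]: "X i \<in> borel_measurable M" if "i \<in> ?I" for i
    using assms(2) that by (auto simp: indep_vars_def)
  have tuple [measurable]: "(\<lambda>\<omega>. \<lambda>i\<in>?I. X i \<omega>) \<in> M \<rightarrow>\<^sub>M (\<Pi>\<^sub>M i\<in>?I. borel)"
    using X by (intro measurable_restrict)
  have "indep_vars (\<lambda>_. borel) X ?I"
    by (rule indep_vars_subset[OF assms(2)]) auto
  then have distr: "distr M (\<Pi>\<^sub>M i\<in>?I. borel) (\<lambda>\<omega>. \<lambda>i\<in>?I. X i \<omega>) = (\<Pi>\<^sub>M i\<in>?I. distr M borel (X i))"
    using X by (subst (asm) indep_vars_iff_distr_eq_PiM') auto
  also have "\<dots> = (\<Pi>\<^sub>M i\<in>?I. U)"
    using assms(3) by (intro PiM_cong) (auto simp: U_def)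
  finally have distr: "distr M (\<Pi>\<^sub>M i\<in>?I. borel) (\<lambda>\<omega>. \<lambda>i\<in>?I. X i \<omega>) = (\<Pi>\<^sub>M i\<in>?I. U)" .
  let ?E = "{x \<in> space (\<Pi>\<^sub>M i\<in>?I. borel). chain_event \<theta> 1 (n + 1) z x}"
  let ?C = "{\<omega> \<in> space M. chain_event \<theta> 1 (n + 1) z (\<lambda>i\<in>?I. X i \<omega>)}"
  have C_eq: "?C = (\<lambda>\<omega>. \<lambda>i\<in>?I. X i \<omega>) -` ?E \<inter> space M"
    using measurable_space[OF tuple] by auto
  have C_sets: "?C \<in> events"
    unfolding C_eq by (rule measurable_sets[OF tuple sets_chain_event])
  have "emeasure M ?C = emeasure (\<Pi>\<^sub>M i\<in>?I. U) ?E"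
    unfolding C_eq distr[symmetric] by (rule emeasure_distr[symmetric, OF tuple sets_chain_event])
  also have "\<dots> = (\<integral>\<^sup>+x. indicator ?E x \<partial>(\<Pi>\<^sub>M i\<in>?I. U))"
    using sets_chain_event[of 1 "n + 1" \<theta> z]
    by (intro nn_integral_indicator[symmetric]) (simp only: distr[symmetric] sets_distr)
  also have "\<dots> = (\<integral>\<^sup>+x. indicator {x. chain_event \<theta> 1 (n + 1) z x} x \<partial>(\<Pi>\<^sub>M i\<in>?I. U))"
    unfolding distr[symmetric] by (intro nn_integral_cong) (simp add: indicator_def)
  also have "\<dots> = ennreal (survival_poly \<theta> (n + 1) z / (1 + a) ^ (n + 1))"
    using nn_integral_chain_event[OF assms(4-6) _ z, of 1 "n + 1"] by (simp add: U_def)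
  finally have "emeasure M ?C = ennreal (survival_poly \<theta> (n + 1) z / (1 + a) ^ (n + 1))" .
  moreover have "survival_poly \<theta> (n + 1) z / (1 + a) ^ (n + 1) \<ge> 0"
  proof -
    have "- 1 / \<theta> > 0" using assms(5) by simp
    then have "1 + a > 0" using assms(6) by linarith
    then show ?thesis
      using survival_poly_nonneg[OF assms(4,5) z] by simp
  qed
  ultimately have C: "measure M ?C = survival_poly \<theta> (n + 1) z / (1 + a) ^ (n + 1)"
    by (simp add: measure_def)
  let ?P = "{\<omega> \<in> space M. \<forall>i\<in>{1..n}. X (i + 1) \<omega> \<ge> \<theta> * X i \<omega>}"
  have C_iff: "chain_event \<theta> 1 (n + 1) z (\<lambda>i\<in>?I. X i \<omega>) \<longleftrightarrow>
      1 / \<theta> \<le> X 1 \<omega> \<and> (\<forall>i\<in>{1..n}. \<theta> * X i \<omega> \<le> X (i + 1) \<omega>)" for \<omega>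
  proof -
    have "\<theta> * z = 1 / \<theta>"
      using assms by (simp add: z_def power2_eq_square)
    moreover have "(\<forall>i\<in>?I. Q i) \<longleftrightarrow> Q 1 \<and> (\<forall>i\<in>{1..n}. Q (Suc i))" for Q
    proof -
      have "?I = insert 1 (Suc ` {1..n})"
        by (auto simp: image_Suc_atLeastAtMost)
      then show ?thesis by (simp del: image_Suc_atLeastAtMost)
    qed
    ultimately show ?thesis
      unfolding chain_event_def by auto
  qed
  have "?P \<in> events"
    by (intro sets.sets_Collect_finite_All) (auto intro!: borel_measurable_le borel_measurable_times X)
  \<comment> \<open>The added condition is implied almost surely: if \<open>X 1 < 1 / \<theta>\<close>, then \<open>X 2 \<ge> \<theta> * X 1 > 1\<close>.\<close>
  moreover have "AE \<omega> in M. \<omega> \<in> ?P \<longleftrightarrow> \<omega> \<in> ?C"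
  proof -
    have distr_2: "distr M borel (X 2) = uniform_measure lborel {-a..1}"
      by (rule assms(3)) simp
    have "AE x in distr M borel (X 2). x \<le> 1"
      unfolding distr_2 by (rule AE_uniform_measureI) auto
    then have "AE \<omega> in M. X 2 \<omega> \<le> 1"
      using n by (intro AE_distrD[of "X 2"] X) auto
    then show ?thesis
    proof eventually_elim
      case (elim \<omega>)
      have "1 / \<theta> \<le> X 1 \<omega>" if "\<forall>i\<in>{1..n}. X (i + 1) \<omega> \<ge> \<theta> * X i \<omega>"
      proof -
        have "\<theta> * X 1 \<omega> \<le> X (1 + 1) \<omega>" using that n by auto
        with elim have "\<theta> * X 1 \<omega> \<le> 1" by (simp add: numeral_2_eq_2)
        then show ?thesis using assms by (simp add: field_simps)
      qed
      then show ?case unfolding mem_Collect_eq C_iff by blast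
    qed
  qed
  ultimately have "measure M ?P = measure M ?C"
    using C_sets by (intro measure_eq_AE)
  then have "persistence_prob M X \<theta> n = survival_poly \<theta> (n + 1) z / (1 + a) ^ (n + 1)"
    using n C by (simp add: persistence_prob_def)
  also have "\<dots> = (- 1) ^ (n + 1) / (1 + a) ^ (n + 1) *
      (\<Sum>k=0..n + 1. \<theta> powi (int k * (int k - 3) div 2) / fact k * phi (n + 1 - k) \<theta>)"
    using assms unfolding z_def by (subst survival_poly_inverse_square) simp_all
  finally show "persistence_prob M X \<theta> n = (- 1) ^ (n + 1) / (1 + a) ^ (n + 1) *
      (\<Sum>k=0..n + 1. \<theta> powi (int k * (int k - 3) div 2) / fact k * phi (n + 1 - k) \<theta>)" .
qed

end
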